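(* Let $n\ge 1$ and $k\ge 1$ be integers and let $(X,d)$ be a metric star tree with $k$ leaves. Then $(X,d)$ can be isometrically embedded into $(\mathbb{R}^n,d_\infty)$ if and only if $k\le 2^n$.
   Context: Metric star tree: given $k\in\mathbb{N}$ and positive real numbers $a_1,\dots,a_k$, the metric star tree with these edge lengths is the set $X$ consisting of a center $o$ and the points $(i,t)$ with $1\le i\le k$ and $0<t\le a_i$, equipped with the metric $d(o,(i,t))=t$, $d((i,t),(i,s))=|t-s|$, and $d((i,t),(j,s))=t+s$ for $i\ne j$. Its leaves are the $k$ points $(i,a_i)$, $i=1,\dots,k$. The metric $d_\infty$ on $\mathbb{R}^n$ is the maximum metric $d_\infty(x,y)=\max_{1\le i\le n}|x_i-y_i|$. An isometric embedding is a distance-preserving map (not necessarily surjective) defined on all of $X$. *)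

theory Defs
  imports "HOL-Analysis.Analysis"
begin

datatype star_point = Center | Pt nat real

definition star_tree :: "nat \<Rightarrow> (nat \<Rightarrow> real) \<Rightarrow> star_point set" where
  "star_tree k a = insert Center {Pt i t | i t. 1 \<le> i \<and> i \<le> k \<and> 0 < t \<and> t \<le> a i}"

definition star_leaves :: "nat \<Rightarrow> (nat \<Rightarrow> real) \<Rightarrow> star_point set" where
  "star_leaves k a = (\<lambda>i. Pt i (a i)) ` {1..k}"

(* Only meaningful on star_tree k a, where all the parameters t are positive. *)
fun star_dist :: "star_point \<Rightarrow> star_point \<Rightarrow> real" where
  "star_dist Center Center = 0"
| "star_dist Center (Pt i t) = t"
| "star_dist (Pt i t) Center = t"
| "star_dist (Pt i t) (Pt j s) = (if i = j then \<bar>t - s\<bar> else t + s)"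

definition d_inf :: "real ^ 'n \<Rightarrow> real ^ 'n \<Rightarrow> real" where
  "d_inf x y = Max (range (\<lambda>i. \<bar>x $ i - y $ i\<bar>))"

definition isometric_embedding ::
  "'a set \<Rightarrow> ('a \<Rightarrow> 'a \<Rightarrow> real) \<Rightarrow> 'b set \<Rightarrow> ('b \<Rightarrow> 'b \<Rightarrow> real) \<Rightarrow> ('a \<Rightarrow> 'b) \<Rightarrow> bool" where
  "isometric_embedding X d Y d' f \<longleftrightarrow>
     f \<in> X \<rightarrow> Y \<and> (\<forall>x\<in>X. \<forall>y\<in>X. d' (f x) (f y) = d x y)"

lemma d_inf_eq_infnorm: "d_inf x y = infnorm (x - y)"
  by (simp add: d_inf_def infnorm_cart cSup_eq_Max full_SetCompr_eq)

lemma card_star_leaves: "card (star_leaves k a) = k"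
  by (simp add: star_leaves_def card_image inj_on_def)

lemma star_leaves_subset:
  assumes "\<And>i. 1 \<le> i \<Longrightarrow> i \<le> k \<Longrightarrow> 0 < a i"
  shows "star_leaves k a \<subseteq> star_tree k a"
  using assms by (auto simp: star_leaves_def star_tree_def)

lemma star_dist_commute: "star_dist p q = star_dist q p"
  by (cases p; cases q) auto

lemma star_dist_nonneg: "p \<in> star_tree k a \<Longrightarrow> q \<in> star_tree k a \<Longrightarrow> 0 \<le> star_dist p q"
  by (cases p; cases q) (auto simp: star_tree_def)

lemma star_dist_zero_iff:
  "p \<in> star_tree k a \<Longrightarrow> q \<in> star_tree k a \<Longrightarrow> star_dist p q = 0 \<longleftrightarrow> p = q"
  by (cases p; cases q) (auto simp: star_tree_def)

lemma star_dist_triangle: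
  "p \<in> star_tree k a \<Longrightarrow> q \<in> star_tree k a \<Longrightarrow> r \<in> star_tree k a \<Longrightarrow>
     star_dist p r \<le> star_dist p q + star_dist q r"
  by (cases p; cases q; cases r) (auto simp: star_tree_def)

end

theory Submission
  imports Defs
begin

text \<open>
  Both directions come from attaching to each edge of the star the subset of coordinates
  that are larger at its leaf than at the center; there are exactly
  \<open>2 ^ n\<close> subsets of the \<open>n\<close> coordinates.

  Two leaves on different edges are at distance \<open>a i + a j\<close>, the largest value that the
  triangle inequality through the center permits.  The maximum metric attains this value in
  some coordinate, and there the two displacements from the center, bounded by \<open>a i\<close> and
  \<open>a j\<close>, can only add up if they have opposite signs.  Hence different edges have different
  subsets (\<open>separated_displacements_opposite_signs\<close>), which gives
  \<open>k \<le> 2 ^ n\<close>.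

  Conversely, if the edges are given pairwise different subsets, send each edge along the ray
  from the origin whose direction is \<open>1\<close> on the subset and \<open>-1\<close> off it.  This is an isometric
  embedding (\<open>diagonal_map_isometric\<close>): on one edge every coordinate moves at unit speed,
  and on two different edges some coordinate moves in opposite directions, so that the two distances from the center add up.
\<close>

lemma abs_diff_le_d_inf: "\<bar>x $ c - y $ c\<bar> \<le> d_inf x y"
  unfolding d_inf_def by (rule Max_ge) auto

lemma d_inf_attained:
  obtains c where "d_inf x y = \<bar>x $ c - y $ c\<bar>"
proof -
  have "d_inf x y \<in> range (\<lambda>c. \<bar>x $ c - y $ c\<bar>)"
    unfolding d_inf_def by (rule Max_in) auto
  then show thesis using that by auto
qed

lemma d_inf_eqI:
  assumes "\<And>c. \<bar>x $ c - y $ c\<bar> \<le> r" and "\<bar>x $ c0 - y $ c0\<bar> = r"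
  shows "d_inf x y = r"
  unfolding d_inf_def using assms by (intro Max_eqI) auto

text \<open>
  Equality in the triangle inequality through \<open>z\<close> must occur in the coordinate that attains
  the distance of \<open>x\<close> and \<open>y\<close>; positivity of both distances excludes a zero displacement.
\<close>

lemma separated_displacements_opposite_signs:
  assumes "d_inf x y = d_inf x z + d_inf y z" and "0 < d_inf x z" and "0 < d_inf y z"
  shows "{c. z $ c < x $ c} \<noteq> {c. z $ c < y $ c}"
proof -
  obtain c where "d_inf x y = \<bar>x $ c - y $ c\<bar>"
    by (rule d_inf_attained)
  moreover have "\<bar>x $ c - z $ c\<bar> \<le> d_inf x z" "\<bar>y $ c - z $ c\<bar> \<le> d_inf y z"
    by (rule abs_diff_le_d_inf)+
  ultimately have "z $ c < x $ c \<longleftrightarrow> \<not> z $ c < y $ c"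
    using assms by linarith
  then show ?thesis by blast
qed

definition sign_vector :: "'n set \<Rightarrow> real ^ 'n" where
  "sign_vector S = (\<chi> c. if c \<in> S then 1 else -1)"

lemma d_inf_scaled_sign_vector: "d_inf (t *\<^sub>R sign_vector S) (s *\<^sub>R sign_vector S) = \<bar>t - s\<bar>"
  by (rule d_inf_eqI) (auto simp: sign_vector_def)

lemma d_inf_scaled_sign_vectors_distinct:
  assumes "S \<noteq> T" and "0 \<le> t" and "0 \<le> s"
  shows "d_inf (t *\<^sub>R sign_vector S) (s *\<^sub>R sign_vector T) = t + s"
proof -
  obtain c where "c \<in> S \<longleftrightarrow> c \<notin> T"
    using assms(1) by blast
  then show ?thesis
    using assms(2,3) by (intro d_inf_eqI[where ?c0.0 = c]) (auto simp: sign_vector_def)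
qed

fun diagonal_map :: "(nat \<Rightarrow> 'n set) \<Rightarrow> star_point \<Rightarrow> real ^ 'n" where
  "diagonal_map S Center = 0"
| "diagonal_map S (Pt i t) = t *\<^sub>R sign_vector (S i)"

lemma diagonal_map_isometric:
  fixes S :: "nat \<Rightarrow> 'n::finite set"
  assumes "inj_on S {1..k}"
  shows "isometric_embedding (star_tree k a) star_dist UNIV d_inf (diagonal_map S)"
proof -
  have center: "d_inf 0 (t *\<^sub>R sign_vector T) = t" "d_inf (t *\<^sub>R sign_vector T) 0 = t"
    if "0 < t" for t and T :: "'n set"
    \<comment> \<open>The center lies on every diagonal, at parameter zero.\<close>
    using d_inf_scaled_sign_vector[of 0 T t] d_inf_scaled_sign_vector[of t T 0] that by simp_all
  have zero: "d_inf (0 :: real ^ 'n) 0 = 0"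
    by (rule d_inf_eqI) auto
  have "d_inf (diagonal_map S p) (diagonal_map S q) = star_dist p q"
    if "p \<in> star_tree k a" and "q \<in> star_tree k a" for p q
  proof (cases p; cases q)
    fix i t j s
    assume pq: "p = Pt i t" "q = Pt j s"
    show ?thesis
    proof (cases "i = j")
      case True
      then show ?thesis by (simp add: pq d_inf_scaled_sign_vector)
    next
      case False
      moreover have "i \<in> {1..k}" "j \<in> {1..k}" "0 < t" "0 < s"
        using that by (auto simp: pq star_tree_def)
      ultimately have "S i \<noteq> S j"
        using assms by (auto dest: inj_onD)
      then show ?thesis
        using False \<open>0 < t\<close> \<open>0 < s\<close> by (simp add: pq d_inf_scaled_sign_vectors_distinct)
    qed
  qed (use that in \<open>auto simp: star_tree_def center zero\<close>)
  then show ?thesis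
    by (simp add: isometric_embedding_def)
qed

lemma positive_coordinates_inj_on:
  fixes f :: "star_point \<Rightarrow> real ^ 'n"
  assumes pos: "\<And>i. 1 \<le> i \<Longrightarrow> i \<le> k \<Longrightarrow> 0 < a i"
    and f: "isometric_embedding (star_tree k a) star_dist UNIV d_inf f"
  shows "inj_on (\<lambda>i. {c. f Center $ c < f (Pt i (a i)) $ c}) {1..k}"
proof (rule inj_onI, rule ccontr)
  fix i j
  assume ij: "i \<in> {1..k}" "j \<in> {1..k}" "i \<noteq> j"
    and eq: "{c. f Center $ c < f (Pt i (a i)) $ c} = {c. f Center $ c < f (Pt j (a j)) $ c}"
  have iso: "d_inf (f p) (f q) = star_dist p q"
    if "p \<in> star_tree k a" "q \<in> star_tree k a" for p q
    using f that by (simp add: isometric_embedding_def)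
  have "Center \<in> star_tree k a" "Pt i (a i) \<in> star_tree k a" "Pt j (a j) \<in> star_tree k a"
    using ij pos by (auto simp: star_tree_def)
  then have "{c. f Center $ c < f (Pt i (a i)) $ c} \<noteq> {c. f Center $ c < f (Pt j (a j)) $ c}"
    using ij pos by (intro separated_displacements_opposite_signs) (simp_all add: iso)
  with eq show False by contradiction
qed

theorem proposition3p1:
  fixes k :: nat and a :: "nat \<Rightarrow> real"
  assumes "k \<ge> 1"
    and "\<And>i. 1 \<le> i \<Longrightarrow> i \<le> k \<Longrightarrow> a i > 0"
  shows "(\<exists>f :: star_point \<Rightarrow> real ^ 'n.
            isometric_embedding (star_tree k a) star_dist UNIV d_inf f)
         \<longleftrightarrow> k \<le> 2 ^ CARD('n)"
proof -
  have subsets: "card (UNIV :: 'n set set) = 2 ^ CARD('n)"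
    by (metis Pow_UNIV card_Pow finite_class.finite_UNIV)
  show ?thesis
  proof
    assume "\<exists>f :: star_point \<Rightarrow> real ^ 'n.
              isometric_embedding (star_tree k a) star_dist UNIV d_inf f"
    then obtain f :: "star_point \<Rightarrow> real ^ 'n"
      where "isometric_embedding (star_tree k a) star_dist UNIV d_inf f" ..
    then have "inj_on (\<lambda>i. {c. f Center $ c < f (Pt i (a i)) $ c}) {1..k}"
      by (intro positive_coordinates_inj_on assms(2))
    then have "card {1..k} \<le> card (UNIV :: 'n set set)"
      by (rule card_inj_on_le) auto
    then show "k \<le> 2 ^ CARD('n)"
      by (simp add: subsets)
  next
    assume "k \<le> 2 ^ CARD('n)"
    then have "card {1..k} \<le> card (UNIV :: 'n set set)"
      by (simp add: subsets)
    then obtain S :: "nat \<Rightarrow> 'n set" where "inj_on S {1..k}"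
      using card_le_inj[of "{1..k}" "UNIV :: 'n set set"] by auto
    then show "\<exists>f :: star_point \<Rightarrow> real ^ 'n.
                 isometric_embedding (star_tree k a) star_dist UNIV d_inf f"
      using diagonal_map_isometric by blast
  qed
qed

end
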